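(* A well-founded connectivity $\mathcal{C}$ in a complete lattice $L$ is a typical connectivity in $L$ if and only if it is not a kernel connectivity. Consequently, a connectivity $\mathcal{C}$ in a complete lattice $L$ is a Serra connectivity if and only if it is not a kernel connectivity and is saturated.
   Context: Let $L$ be a complete lattice with bottom $0$ and $\mathcal{C}\subseteq L$. In a poset $P$, a mail is a non-empty subset having a common lower bound in $P$; a subset $M$ of $P$ is mail-connected if $M\neq\varnothing$ and for any $x,y\in M$ there is a sequence $s_1,\dots,s_n\in M$ with $s_1=x$, $s_n=y$ and each $\{s_i,s_{i+1}\}$ a mail in $P$. $\mathcal{C}$ is a connectivity in $L$ if for every $M\subseteq\mathcal{C}$ that is mail-connected in the poset $\mathcal{C}$ (with the induced order), the join of $M$ in $L$ belongs to $\mathcal{C}$. A connectivity $\mathcal{C}$ in $L$ is: a kernel connectivity if $0\in\mathcal{C}$; well-founded if for every $a\in L$ with $a\neq 0$ there exists $c\in\mathcal{C}$ with $c\leqslant a$; saturated if every element of $L$ is a join of elements from $\mathcal{C}$. A subset $\mathcal{C}\subseteq L$ is a typical connectivity in $L$ if $0\notin\mathcal{C}$ and the join of every non-empty subset $X\subseteq\mathcal{C}$ that has a lower bound in $L$ different from $0$ belongs to $\mathcal{C}$. A Serra connectivity in $L$ is a typical connectivity $\mathcal{C}$ in $L$ such that every element of $L$ is a join of elements from $\mathcal{C}$. *)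

theory Defs
  imports Main
begin

text \<open>
  A poset is given by a carrier set \<open>P\<close> inside an ordered type, with the induced order.
  The lower bound of a mail has to lie in \<open>P\<close> itself.
\<close>

definition mail :: "'a::order set \<Rightarrow> 'a set \<Rightarrow> bool" where
  "mail P M \<longleftrightarrow> M \<subseteq> P \<and> M \<noteq> {} \<and> (\<exists>l\<in>P. \<forall>x\<in>M. l \<le> x)"

definition mail_connected :: "'a::order set \<Rightarrow> 'a set \<Rightarrow> bool" where
  "mail_connected P M \<longleftrightarrow> M \<subseteq> P \<and> M \<noteq> {} \<and>
     (\<forall>x\<in>M. \<forall>y\<in>M. \<exists>(n::nat) s. 1 \<le> n \<and> (\<forall>i\<in>{1..n}. s i \<in> M) \<and> s 1 = x \<and> s n = y \<and>
        (\<forall>i\<in>{1..<n}. mail P {s i, s (i + 1)}))"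

definition connectivity :: "'a::complete_lattice set \<Rightarrow> bool" where
  "connectivity C \<longleftrightarrow> (\<forall>M. M \<subseteq> C \<longrightarrow> mail_connected C M \<longrightarrow> Sup M \<in> C)"

definition kernel_connectivity :: "'a::complete_lattice set \<Rightarrow> bool" where
  "kernel_connectivity C \<longleftrightarrow> connectivity C \<and> bot \<in> C"

definition well_founded_connectivity :: "'a::complete_lattice set \<Rightarrow> bool" where
  "well_founded_connectivity C \<longleftrightarrow>
     connectivity C \<and> (\<forall>a. a \<noteq> bot \<longrightarrow> (\<exists>c\<in>C. c \<le> a))"

text \<open>
  Joins of elements of \<open>C\<close> include the empty join \<open>bot\<close>, here and in Serra connectivities.
\<close>

definition saturated_connectivity :: "'a::complete_lattice set \<Rightarrow> bool" where
  "saturated_connectivity C \<longleftrightarrow> connectivity C \<and> (\<forall>a. \<exists>X. X \<subseteq> C \<and> a = Sup X)"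

definition typical_connectivity :: "'a::complete_lattice set \<Rightarrow> bool" where
  "typical_connectivity C \<longleftrightarrow> bot \<notin> C \<and>
     (\<forall>X. X \<subseteq> C \<longrightarrow> X \<noteq> {} \<longrightarrow> (\<exists>l. l \<noteq> bot \<and> (\<forall>x\<in>X. l \<le> x)) \<longrightarrow> Sup X \<in> C)"

definition Serra_connectivity :: "'a::complete_lattice set \<Rightarrow> bool" where
  "Serra_connectivity C \<longleftrightarrow>
     typical_connectivity C \<and> (\<forall>a. \<exists>X. X \<subseteq> C \<and> a = Sup X)"

end

theory Submission
  imports Defs
begin

text \<open>Connectivity asks for lower bounds inside \<open>C\<close>, typicality only for a
  nonzero lower bound in the lattice. Well-foundedness bridges the two: below a nonzero lower bound
  of \<open>X\<close> lies some \<open>c\<close> in \<open>C\<close>, so any two members of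
  \<open>X\<close> form a mail, \<open>X\<close> is mail-connected
  (\<open>mail_connected_if_lower_bound\<close>), and its join is in \<open>C\<close>. The other
  clause of typicality, \<open>bot \<notin> C\<close>, is for a connectivity the negation of being
  kernel. The Serra case reduces to this one because saturation implies well-foundedness
  (\<open>saturated_imp_well_founded\<close>).\<close>

lemma mail_connected_if_lower_bound:
  assumes "M \<subseteq> P" "M \<noteq> {}" "c \<in> P" and lower: "\<And>x. x \<in> M \<Longrightarrow> c \<le> x"
  shows "mail_connected P M"
  unfolding mail_connected_def
proof (intro conjI ballI)
  fix x y assume "x \<in> M" "y \<in> M"
  \<comment> \<open>Since \<open>c\<close> bounds every pair from below, a sequence of length 2
    suffices; its only link is the one at index 1.\<close>
  define s :: "nat \<Rightarrow> 'a" where "s i = (if i = 1 then x else y)" for i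
  have "mail P {x, y}"
    using assms \<open>x \<in> M\<close> \<open>y \<in> M\<close> unfolding mail_def by auto
  then have "\<forall>i\<in>{1..<2}. mail P {s i, s (i + 1)}"
    by (simp add: s_def)
  moreover have "\<forall>i\<in>{1..2}. s i \<in> M" "s 1 = x" "s 2 = y"
    using \<open>x \<in> M\<close> \<open>y \<in> M\<close> by (simp_all add: s_def)
  ultimately show "\<exists>(n::nat) s. 1 \<le> n \<and> (\<forall>i\<in>{1..n}. s i \<in> M) \<and> s 1 = x \<and> s n = y \<and>
      (\<forall>i\<in>{1..<n}. mail P {s i, s (i + 1)})"
    by (intro exI[of _ 2] exI[of _ s]) simp
qed (use assms in auto)

lemma typical_iff_not_kernel:
  fixes C :: "'a::complete_lattice set"
  assumes "well_founded_connectivity C"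
  shows "typical_connectivity C \<longleftrightarrow> \<not> kernel_connectivity C"
proof
  show "\<not> kernel_connectivity C" if "typical_connectivity C"
    using that by (simp add: typical_connectivity_def kernel_connectivity_def)
next
  assume "\<not> kernel_connectivity C"
  have conn: "connectivity C" and wf: "\<And>a. a \<noteq> bot \<Longrightarrow> \<exists>c\<in>C. c \<le> a"
    using assms by (auto simp: well_founded_connectivity_def)
  have "Sup X \<in> C" if X: "X \<subseteq> C" "X \<noteq> {}" and l: "l \<noteq> bot" "\<forall>x\<in>X. l \<le> x" for X l
  proof -
    \<comment> \<open>The bound \<open>l\<close> need not lie in \<open>C\<close>; being nonzero, it
      can be replaced by a smaller \<open>c\<close> that does.\<close>
    obtain c where "c \<in> C" "c \<le> l" using wf l(1) by blast
    then have "mail_connected C X"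
      using X l(2) by (intro mail_connected_if_lower_bound[of X C c]) (auto intro: order_trans)
    then show ?thesis using conn X(1) by (simp add: connectivity_def)
  qed
  moreover have "bot \<notin> C"
    using \<open>\<not> kernel_connectivity C\<close> conn by (simp add: kernel_connectivity_def)
  ultimately show "typical_connectivity C"
    unfolding typical_connectivity_def by blast
qed

text \<open>The empty join is \<open>bot\<close>, so a family in \<open>C\<close> with nonzero join
  has a member, and every member lies below the join.\<close>

lemma saturated_imp_well_founded:
  fixes C :: "'a::complete_lattice set"
  assumes "saturated_connectivity C"
  shows "well_founded_connectivity C"
  unfolding well_founded_connectivity_def
proof (intro conjI allI impI)
  show "connectivity C" using assms by (simp add: saturated_connectivity_def)
next
  fix a :: 'a assume "a \<noteq> bot"
  obtain X where X: "X \<subseteq> C" "a = Sup X"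
    using assms by (auto simp: saturated_connectivity_def)
  with \<open>a \<noteq> bot\<close> obtain c where "c \<in> X" by fastforce
  then show "\<exists>c\<in>C. c \<le> a" using X by (auto intro: Sup_upper)
qed

theorem corollary37:
  "(\<forall>C :: 'a::complete_lattice set. well_founded_connectivity C \<longrightarrow>
      (typical_connectivity C \<longleftrightarrow> \<not> kernel_connectivity C)) \<and>
   (\<forall>C :: 'a::complete_lattice set. connectivity C \<longrightarrow>
      (Serra_connectivity C \<longleftrightarrow> \<not> kernel_connectivity C \<and> saturated_connectivity C))"
proof (intro conjI allI impI)
  fix C :: "'a set" assume "well_founded_connectivity C"
  then show "typical_connectivity C \<longleftrightarrow> \<not> kernel_connectivity C"
    by (rule typical_iff_not_kernel)
next
  fix C :: "'a set" assume "connectivity C"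
  \<comment> \<open>For a connectivity, the join clause of a Serra connectivity is exactly
    saturation.\<close>
  then have "Serra_connectivity C \<longleftrightarrow> typical_connectivity C \<and> saturated_connectivity C"
    by (simp add: Serra_connectivity_def saturated_connectivity_def)
  \<comment> \<open>The conjunct \<open>saturated_connectivity C\<close> stands on both sides, so
    well-foundedness may be assumed when comparing the other conjuncts.\<close>
  also have "\<dots> \<longleftrightarrow> \<not> kernel_connectivity C \<and> saturated_connectivity C"
    using typical_iff_not_kernel saturated_imp_well_founded by blast
  finally show "Serra_connectivity C \<longleftrightarrow> \<not> kernel_connectivity C \<and> saturated_connectivity C" .
qed

end
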